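(* Consider the asymmetric log-GARCH$(p,q)$ model with innovations $(\eta_t)$ and the associated matrices $\boldsymbol{C}_t$ and $\boldsymbol{A}^{(\infty)}$ defined in the context, and let $r=\max\{p,q\}$. Suppose that $\gamma(\mathbf{C})<0$ and that $$\rho(\boldsymbol{A}^{(\infty)})<1\qquad\text{or, equivalently,}\qquad \sum_{i=1}^r\max\left\{|\alpha_{i+}+\beta_i|,\,|\alpha_{i-}+\beta_i|\right\}<1.$$ Then the strictly stationary solution $(\epsilon_t)$ of the model satisfies $E|\log\epsilon_t^2|^m<\infty$ at any order $m>0$ such that $E|\log\eta_0^2|^m<\infty$.
   Context: **Model.** The asymmetric log-GARCH$(p,q)$ model is, for $t\in\mathbb{Z}$, $$\epsilon_t=\sigma_t\eta_t,\qquad \log\sigma_t^2=\omega+\sum_{i=1}^q\left(\alpha_{i+}1_{\{\epsilon_{t-i}>0\}}+\alpha_{i-}1_{\{\epsilon_{t-i}<0\}}\right)\log\epsilon_{t-i}^2+\sum_{j=1}^p\beta_j\log\sigma_{t-j}^2,$$ where $\sigma_t>0$, the coefficients $\omega,\alpha_{i+},\alpha_{i-},\beta_j$ are real (no sign constraints), and $(\eta_t)_{t\in\mathbb{Z}}$ is a given iid sequence of real random variables with $E\eta_0=0$, $E\eta_0^2=1$. Convention: $\log 0=-\infty$, so that finiteness of a moment of $|\log\eta_0^2|$ entails $P(\eta_0=0)=0$. Write $\boldsymbol{\alpha}_+=(\alpha_{1+},\dots,\alpha_{q+})$, $\boldsymbol{\alpha}_-=(\alpha_{1-},\dots,\alpha_{q-})$,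 $\boldsymbol{\beta}=(\beta_1,\dots,\beta_p)$ (row vectors). **Matrices $\boldsymbol{C}_t$.** $\boldsymbol{I}_k$ is the $k\times k$ identity, $\mathbf{0}$ denotes zero vectors/matrices of the indicated size. $\boldsymbol{C}_t$ is the $(2q+p)\times(2q+p)$ matrix $$\boldsymbol{C}_t=\begin{pmatrix}1_{\{\eta_t>0\}}\boldsymbol{\alpha}_+&1_{\{\eta_t>0\}}\boldsymbol{\alpha}_-&1_{\{\eta_t>0\}}\boldsymbol{\beta}\\ (\boldsymbol{I}_{q-1}\ \mathbf{0}_{q-1})&\mathbf{0}_{(q-1)\times q}&\mathbf{0}_{(q-1)\times p}\\ 1_{\{\eta_t<0\}}\boldsymbol{\alpha}_+&1_{\{\eta_t<0\}}\boldsymbol{\alpha}_-&1_{\{\eta_t<0\}}\boldsymbol{\beta}\\ \mathbf{0}_{(q-1)\times q}&(\boldsymbol{I}_{q-1}\ \mathbf{0}_{q-1})&\mathbf{0}_{(q-1)\times p}\\ \boldsymbol{\alpha}_+&\boldsymbol{\alpha}_-&\boldsymbol{\beta}\\ \mathbf{0}_{(p-1)\times q}&\mathbf{0}_{(p-1)\times q}&(\boldsymbol{I}_{p-1}\ \mathbf{0}_{p-1})\end{pmatrix}$$ (with obvious changes, i.e. empty blocks dropped, when $p\le1$ or $q\le1$). $\gamma(\mathbf{C})=\lim_{t\to\infty}\frac1tE\log\|\boldsymbol{C}_t\cdots\boldsymbol{C}_1\|=\inf_{t\ge1}\frac1tE\log\|\boldsymbol{C}_t\cdots\boldsymbol{C}_1\|$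 is the top Lyapunov exponent of $\mathbf{C}=(\boldsymbol{C}_t)$ (for any multiplicative matrix norm). **Matrix $\boldsymbol{A}^{(\infty)}$.** With $\mu_i(\eta_t)=\alpha_{i+}1_{\{\eta_t>0\}}+\alpha_{i-}1_{\{\eta_t<0\}}+\beta_i$ for $1\le i\le r$, where $\alpha_{i+}=\alpha_{i-}=0$ for $i>q$ and $\beta_i=0$ for $i>p$, $\boldsymbol{A}_t$ is the $r\times r$ companion matrix $$\boldsymbol{A}_t=\begin{pmatrix}\mu_1(\eta_{t-1})\ \cdots\ \mu_{r-1}(\eta_{t-r+1})&\mu_r(\eta_{t-r})\\ \boldsymbol{I}_{r-1}&\mathbf{0}_{r-1}\end{pmatrix}.$$ $\mathrm{Abs}(\boldsymbol{M})$ is the matrix of absolute values of the entries of $\boldsymbol{M}$, and $\boldsymbol{A}^{(\infty)}=\mathrm{ess\,sup}\,\mathrm{Abs}(\boldsymbol{A}_1)$, the essential supremum being taken entry by entry. $\rho(\cdot)$ is the spectral radius. **Stationary solution.** When $\gamma(\mathbf{C})<0$ and $E\log^+|\log\eta_0^2|<\infty$, the model has a unique strictly stationary solution $(\epsilon_t,\sigma_t)_{t\in\mathbb{Z}}$, which is nonanticipative and ergodic; this is the solution referred to. *)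

theory Defs
  imports "HOL-Probability.Probability" "Jordan_Normal_Form.Spectral_Radius"
begin

text \<open>
  The coefficients of the model are families \<open>ap\<close> (for \<open>\<alpha>\<^sub>+\<close>), \<open>am\<close> (for \<open>\<alpha>\<^sub>-\<close>) of which the
  indices \<open>1, \<dots>, q\<close> are used, and \<open>b\<close> (for \<open>\<beta>\<close>), of which the indices \<open>1, \<dots>, p\<close> are used.
  Matrix indices start at 0, as in the library.
\<close>

definition trunc_coef :: "nat \<Rightarrow> (nat \<Rightarrow> real) \<Rightarrow> nat \<Rightarrow> real" where
  "trunc_coef n a i = (if 1 \<le> i \<and> i \<le> n then a i else 0)"


subsection \<open>Processes\<close>

definition iid_innovations :: "'a measure \<Rightarrow> (int \<Rightarrow> 'a \<Rightarrow> real) \<Rightarrow> bool" where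
  "iid_innovations M \<eta> \<longleftrightarrow>
     prob_space.indep_vars M (\<lambda>_. borel) \<eta> UNIV \<and>
     (\<forall>t. distr M borel (\<eta> t) = distr M borel (\<eta> 0)) \<and>
     has_bochner_integral M (\<eta> 0) 0 \<and>
     has_bochner_integral M (\<lambda>w. (\<eta> 0 w)\<^sup>2) 1"

definition strictly_stationary ::
    "'a measure \<Rightarrow> (int \<Rightarrow> 'a \<Rightarrow> 'b::topological_space) \<Rightarrow> bool" where
  "strictly_stationary M X \<longleftrightarrow>
     (\<forall>t. X t \<in> borel_measurable M) \<and>
     (\<forall>h. distr M (\<Pi>\<^sub>M t\<in>UNIV. borel) (\<lambda>w t. X (t + h) w) =
          distr M (\<Pi>\<^sub>M t\<in>UNIV. borel) (\<lambda>w t. X t w))"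

text \<open>
  In the ARCH part, both indicators vanish when \<open>\<epsilon> (t - i) w = 0\<close>, so that the corresponding
  summand is \<open>0\<close> whatever the value of \<open>ln 0\<close>.
\<close>

definition log_garch_equations ::
    "nat \<Rightarrow> nat \<Rightarrow> real \<Rightarrow> (nat \<Rightarrow> real) \<Rightarrow> (nat \<Rightarrow> real) \<Rightarrow> (nat \<Rightarrow> real) \<Rightarrow>
     'a measure \<Rightarrow> (int \<Rightarrow> 'a \<Rightarrow> real) \<Rightarrow> (int \<Rightarrow> 'a \<Rightarrow> real) \<Rightarrow> (int \<Rightarrow> 'a \<Rightarrow> real) \<Rightarrow> bool" where
  "log_garch_equations p q \<omega> ap am b M \<eta> \<epsilon> \<sigma> \<longleftrightarrow>
     (\<forall>t. AE w in M.
        \<sigma> t w > 0 \<and>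
        \<epsilon> t w = \<sigma> t w * \<eta> t w \<and>
        ln ((\<sigma> t w)\<^sup>2) =
          \<omega>
          + (\<Sum>i=1..q. (ap i * of_bool (\<epsilon> (t - int i) w > 0) + am i * of_bool (\<epsilon> (t - int i) w < 0))
                        * ln ((\<epsilon> (t - int i) w)\<^sup>2))
          + (\<Sum>j=1..p. b j * ln ((\<sigma> (t - int j) w)\<^sup>2)))"

definition stationary_log_garch_solution ::
    "nat \<Rightarrow> nat \<Rightarrow> real \<Rightarrow> (nat \<Rightarrow> real) \<Rightarrow> (nat \<Rightarrow> real) \<Rightarrow> (nat \<Rightarrow> real) \<Rightarrow>
     'a measure \<Rightarrow> (int \<Rightarrow> 'a \<Rightarrow> real) \<Rightarrow> (int \<Rightarrow> 'a \<Rightarrow> real) \<Rightarrow> (int \<Rightarrow> 'a \<Rightarrow> real) \<Rightarrow> bool" where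
  "stationary_log_garch_solution p q \<omega> ap am b M \<eta> \<epsilon> \<sigma> \<longleftrightarrow>
     strictly_stationary M (\<lambda>t w. (\<epsilon> t w, \<sigma> t w)) \<and>
     log_garch_equations p q \<omega> ap am b M \<eta> \<epsilon> \<sigma>"


subsection \<open>Logarithmic moments\<close>

text \<open>
  The convention is \<open>log 0 = -\<infinity>\<close>, whereas \<open>ln 0 = 0\<close> in the library; hence the case distinctions.
  In \<open>log_plus_abs_log_moment\<close>, which is \<open>E log\<^sup>+ |log X\<^sup>2|\<close>, the value \<open>ln 0 = 0\<close> of the outer
  logarithm agrees with \<open>log\<^sup>+ 0 = 0\<close>.
\<close>

definition abs_log_moment :: "'a measure \<Rightarrow> ('a \<Rightarrow> real) \<Rightarrow> real \<Rightarrow> ennreal" where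
  "abs_log_moment M X m =
     (\<integral>\<^sup>+w. (if X w = 0 then \<infinity> else ennreal (\<bar>ln ((X w)\<^sup>2)\<bar> powr m)) \<partial>M)"

definition log_plus_abs_log_moment :: "'a measure \<Rightarrow> ('a \<Rightarrow> real) \<Rightarrow> ennreal" where
  "log_plus_abs_log_moment M X =
     (\<integral>\<^sup>+w. (if X w = 0 then \<infinity> else ennreal (max 0 (ln \<bar>ln ((X w)\<^sup>2)\<bar>))) \<partial>M)"


subsection \<open>The matrices \<open>C\<^sub>t\<close> and the top Lyapunov exponent\<close>

definition coef_row ::
    "nat \<Rightarrow> (nat \<Rightarrow> real) \<Rightarrow> (nat \<Rightarrow> real) \<Rightarrow> (nat \<Rightarrow> real) \<Rightarrow> nat \<Rightarrow> real" where
  "coef_row q ap am b j =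
     (if j < q then ap (j + 1) else if j < 2 * q then am (j - q + 1) else b (j - 2 * q + 1))"

text \<open>
  \<open>C\<^sub>t\<close> as a function of \<open>x = \<eta>\<^sub>t\<close>. Rows \<open>0\<close>, \<open>q\<close> and \<open>2 * q\<close> are the coefficient rows, and every
  other row \<open>i\<close> is a shift with its single entry \<open>1\<close> in column \<open>i - 1\<close>. The row \<open>2 * q\<close> is tested
  first: for \<open>q = 0\<close> the three indices coincide and only the last block of rows is present.
\<close>

definition C_mat ::
    "nat \<Rightarrow> nat \<Rightarrow> (nat \<Rightarrow> real) \<Rightarrow> (nat \<Rightarrow> real) \<Rightarrow> (nat \<Rightarrow> real) \<Rightarrow> real \<Rightarrow> real mat" where
  "C_mat p q ap am b x =
     Matrix.mat (2 * q + p) (2 * q + p) (\<lambda>(i, j).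
       if i = 2 * q then coef_row q ap am b j
       else if i = 0 then of_bool (x > 0) * coef_row q ap am b j
       else if i = q then of_bool (x < 0) * coef_row q ap am b j
       else of_bool (i = j + 1))"

text \<open>The product \<open>Y n * \<dots> * Y 1\<close>, in this order.\<close>

fun left_product :: "nat \<Rightarrow> (nat \<Rightarrow> real mat) \<Rightarrow> nat \<Rightarrow> real mat" where
  "left_product d Y 0 = 1\<^sub>m d"
| "left_product d Y (Suc n) = Y (Suc n) * left_product d Y n"

definition multiplicative_matrix_norm :: "nat \<Rightarrow> (real mat \<Rightarrow> real) \<Rightarrow> bool" where
  "multiplicative_matrix_norm d N \<longleftrightarrow>
     (\<forall>A \<in> carrier_mat d d. N A \<ge> 0 \<and> (N A = 0 \<longleftrightarrow> A = 0\<^sub>m d d)) \<and>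
     (\<forall>A \<in> carrier_mat d d. \<forall>c. N (c \<cdot>\<^sub>m A) = \<bar>c\<bar> * N A) \<and>
     (\<forall>A \<in> carrier_mat d d. \<forall>B \<in> carrier_mat d d. N (A + B) \<le> N A + N B) \<and>
     (\<forall>A \<in> carrier_mat d d. \<forall>B \<in> carrier_mat d d. N (A * B) \<le> N A * N B)"

text \<open>
  \<open>E log X\<close> for a nonnegative \<open>X\<close>, with \<open>log 0 = -\<infinity>\<close>, as an extended real. It is meaningful
  whenever the positive part has finite expectation, which is the case for the norm of a product
  of the matrices \<open>C\<^sub>t\<close>, since \<open>C\<^sub>t\<close> takes at most three values.
\<close>

definition ext_log :: "real \<Rightarrow> ereal" where
  "ext_log x = (if x = 0 then -\<infinity> else ereal (ln x))"

definition expected_log :: "'a measure \<Rightarrow> ('a \<Rightarrow> real) \<Rightarrow> ereal" where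
  "expected_log M X =
     enn2ereal (\<integral>\<^sup>+w. e2ennreal (ext_log (X w)) \<partial>M) - enn2ereal (\<integral>\<^sup>+w. e2ennreal (- ext_log (X w)) \<partial>M)"

text \<open>
  The infimum form of the exponent, which for the stationary sequence \<open>C\<^sub>t\<close> is also the limit of
  \<open>E log (N (C\<^sub>n \<cdots> C\<^sub>1)) / n\<close>, by subadditivity.
\<close>

definition top_lyapunov_exponent ::
    "(real mat \<Rightarrow> real) \<Rightarrow> nat \<Rightarrow> 'a measure \<Rightarrow> (int \<Rightarrow> 'a \<Rightarrow> real mat) \<Rightarrow> ereal" where
  "top_lyapunov_exponent N d M Y =
     (INF n\<in>{1::nat..}. expected_log M (\<lambda>w. N (left_product d (\<lambda>k. Y (int k) w) n)) / ereal (real n))"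


subsection \<open>The matrix \<open>A\<^sup>(\<^sup>\<infinity>\<^sup>)\<close>\<close>

definition mu_coef ::
    "nat \<Rightarrow> nat \<Rightarrow> (nat \<Rightarrow> real) \<Rightarrow> (nat \<Rightarrow> real) \<Rightarrow> (nat \<Rightarrow> real) \<Rightarrow> nat \<Rightarrow> real \<Rightarrow> real" where
  "mu_coef p q ap am b i x =
     trunc_coef q ap i * of_bool (x > 0) + trunc_coef q am i * of_bool (x < 0) + trunc_coef p b i"

definition A_mat ::
    "nat \<Rightarrow> nat \<Rightarrow> (nat \<Rightarrow> real) \<Rightarrow> (nat \<Rightarrow> real) \<Rightarrow> (nat \<Rightarrow> real) \<Rightarrow>
     (int \<Rightarrow> 'a \<Rightarrow> real) \<Rightarrow> int \<Rightarrow> 'a \<Rightarrow> real mat" where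
  "A_mat p q ap am b \<eta> t w =
     Matrix.mat (max p q) (max p q) (\<lambda>(i, j).
       if i = 0 then mu_coef p q ap am b (j + 1) (\<eta> (t - int (j + 1)) w)
       else of_bool (i = j + 1))"

text \<open>
  The essential supremum of the library lives in a complete linear order, hence the detour
  through \<open>ereal\<close>; as the entries are bounded, nothing is lost by \<open>real_of_ereal\<close>.
\<close>

definition A_inf ::
    "nat \<Rightarrow> nat \<Rightarrow> (nat \<Rightarrow> real) \<Rightarrow> (nat \<Rightarrow> real) \<Rightarrow> (nat \<Rightarrow> real) \<Rightarrow>
     'a measure \<Rightarrow> (int \<Rightarrow> 'a \<Rightarrow> real) \<Rightarrow> real mat" where
  "A_inf p q ap am b M \<eta> =
     Matrix.mat (max p q) (max p q) (\<lambda>(i, j).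
       real_of_ereal (esssup M (\<lambda>w. ereal \<bar>A_mat p q ap am b \<eta> 1 w $$ (i, j)\<bar>)))"

end

theory Submission
  imports Defs
begin

text \<open>
  Put \<open>X\<^sub>t = \<bar>log \<sigma>\<^sub>t\<^sup>2\<bar>\<close> and let \<open>a\<^sub>i\<close> be the maximum of \<open>\<bar>\<alpha>\<^sub>i\<^sub>+ + \<beta>\<^sub>i\<bar>\<close> and \<open>\<bar>\<alpha>\<^sub>i\<^sub>- + \<beta>\<^sub>i\<bar>\<close>.
  The model equation yields \<open>X\<^sub>t \<le> \<Sum>\<^sub>i a\<^sub>i X\<^sub>t\<^sub>-\<^sub>i + W\<^sub>t\<close> almost surely, where \<open>W\<^sub>t\<close> is affine in
  \<open>\<bar>log \<eta>\<^sub>t\<^sub>-\<^sub>i\<^sup>2\<bar>\<close>. As \<open>\<Sum>\<^sub>i a\<^sub>i < 1\<close>, there are \<open>l < 1\<close> and \<open>d\<close> such that, for each \<open>t\<close>, either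
  \<open>X\<^sub>t \<le> d W\<^sub>t\<close> or \<open>X\<^sub>t \<le> l\<^sup>i X\<^sub>t\<^sub>-\<^sub>i\<close> for some \<open>i \<le> r\<close>. Following the second alternative backwards in
  time bounds \<open>X\<^sub>t\<^sup>m\<close> by \<open>\<Sum>\<^sub>s l\<^sup>s\<^sup>m (d W\<^sub>t\<^sub>-\<^sub>s)\<^sup>m\<close> plus a remainder made of \<open>r\<close> terms
  \<open>l\<^sup>s\<^sup>m X\<^sub>t\<^sub>-\<^sub>s\<^sup>m\<close> with large \<open>s\<close>. By stationarity the remainder, truncated at a level \<open>K\<close>, vanishes in
  mean; letting \<open>K\<close> grow gives the moment bound.

  The matrix \<open>A\<^sup>(\<^sup>\<infinity>\<^sup>)\<close> is the companion matrix with first row \<open>a\<^sub>1, \<dots>, a\<^sub>r\<close>, and its eigenvalues are the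
  roots of \<open>x\<^sup>r = \<Sum>\<^sub>i a\<^sub>i x\<^sup>r\<^sup>-\<^sup>i\<close>. If \<open>\<Sum>\<^sub>i a\<^sub>i < 1\<close>, no root has modulus at least 1; otherwise there is a
  real root \<open>x \<ge> 1\<close> by the intermediate value theorem.
\<close>

(* frees "$" for the vectors of Jordan_Normal_Form *)
unbundle no vec_syntax

subsection \<open>Spectral radius of companion matrices\<close>

text \<open>The shift rows force \<open>v $ i = k * v $ (i + 1)\<close>, so an eigenvector is a
  multiple of \<open>(k ^ (r - 1), ..., k, 1)\<close>; the first row then becomes the characteristic
  equation.\<close>

lemma companion_eigenvalue_iff:
  fixes f :: "nat \<Rightarrow> 'a::field"
  assumes r: "1 \<le> r"
  shows "eigenvalue (Matrix.mat r r (\<lambda>(i, j). if i = 0 then f (Suc j) else of_bool (i = Suc j))) k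
     \<longleftrightarrow> k ^ r = (\<Sum>j<r. f (Suc j) * k ^ (r - Suc j))"
    (is "eigenvalue ?A k \<longleftrightarrow> ?eq")
proof -
  have row: "(?A *\<^sub>v v) $ i = (if i = 0 then \<Sum>j<r. f (Suc j) * v $ j else v $ (i - 1))"
    if "v \<in> carrier_vec r" "i < r" for v i
  proof -
    have "(?A *\<^sub>v v) $ i = (\<Sum>j<r. (if i = 0 then f (Suc j) else of_bool (i = Suc j)) * v $ j)"
      using that by (simp add: scalar_prod_def atLeast0LessThan)
    also have "\<dots> = (if i = 0 then \<Sum>j<r. f (Suc j) * v $ j else v $ (i - 1))"
    proof (cases i)
      case (Suc l)
      have "(\<Sum>j<r. of_bool (Suc l = Suc j) * v $ j) = (\<Sum>j<r. if j = l then v $ j else 0)"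
        by (rule sum.cong) auto
      also have "\<dots> = v $ l" using Suc that by simp
      finally show ?thesis using Suc by simp
    qed simp
    finally show ?thesis .
  qed
  have Suc_power: "k * k ^ (r - Suc i) = k ^ (r - i)" if "i < r" for i
    using that by (metis Suc_diff_Suc power_Suc)
  show ?thesis
  proof
    assume "eigenvalue ?A k"
    then obtain v where v: "v \<in> carrier_vec r" "v \<noteq> 0\<^sub>v r" "?A *\<^sub>v v = k \<cdot>\<^sub>v v"
      by (auto simp: eigenvalue_def eigenvector_def)
    \<comment> \<open>The induction runs from the last coordinate up: row \<open>Suc i\<close> of
      the eigenvector equation reads \<open>v $ i = k * v $ Suc i\<close>.\<close>
    have "v $ i = k ^ (r - Suc i) * v $ (r - 1)" if "i < r" for i
      using that
    proof (induction "r - Suc i" arbitrary: i)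
      case 0
      then have "i = r - 1" by simp
      then show ?case by simp
    next
      case (Suc n)
      then have i: "Suc i < r" by simp
      have "v $ i = (?A *\<^sub>v v) $ (Suc i)" using row[OF v(1) i] by simp
      also have "\<dots> = k * v $ Suc i" using v i by simp
      also have "v $ Suc i = k ^ (r - Suc (Suc i)) * v $ (r - 1)"
        using Suc i by (intro Suc.hyps(1)) auto
      finally show ?case using Suc_power[OF i] by (simp add: mult.assoc[symmetric])
    qed
    note vi = this
    have "v $ (r - 1) \<noteq> 0"
    proof
      assume "v $ (r - 1) = 0"
      then have "v $ i = 0" if "i < r" for i using vi[OF that] by simp
      then have "v = 0\<^sub>v r" using v(1) by (intro eq_vecI) auto
      with v(2) show False by simp
    qed
    moreover have "(\<Sum>j<r. f (Suc j) * k ^ (r - Suc j)) * v $ (r - 1) = k ^ r * v $ (r - 1)"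
    proof -
      have "(\<Sum>j<r. f (Suc j) * k ^ (r - Suc j)) * v $ (r - 1) = (\<Sum>j<r. f (Suc j) * v $ j)"
        unfolding sum_distrib_right
      proof (intro sum.cong refl)
        fix j assume "j \<in> {..<r}"
        then have j: "j < r" by simp
        show "f (Suc j) * k ^ (r - Suc j) * v $ (r - 1) = f (Suc j) * v $ j"
          by (simp add: vi[OF j] mult.assoc)
      qed
      also have "\<dots> = (?A *\<^sub>v v) $ 0" using row[OF v(1), of 0] r by simp
      also have "\<dots> = k * v $ 0" using v r by simp
      also have "\<dots> = k ^ r * v $ (r - 1)"
        using vi[of 0] Suc_power[of 0] r by (simp add: mult.assoc[symmetric])
      finally show ?thesis .
    qed
    ultimately show ?eq by simp
  next
    assume eq: ?eq
    define v where "v = Matrix.vec r (\<lambda>i. k ^ (r - Suc i))"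
    have v: "v \<in> carrier_vec r" by (simp add: v_def)
    \<comment> \<open>The last coordinate is \<open>k ^ 0 = 1\<close>, so \<open>v\<close> is
      nonzero even for \<open>k = 0\<close>.\<close>
    have "v $ (r - 1) \<noteq> 0\<^sub>v r $ (r - 1)" using r by (simp add: v_def)
    then have "v \<noteq> 0\<^sub>v r" by metis
    moreover have "?A *\<^sub>v v = k \<cdot>\<^sub>v v"
    proof (rule eq_vecI)
      fix i assume "i < dim_vec (k \<cdot>\<^sub>v v)"
      then have i: "i < r" by (simp add: v_def)
      show "(?A *\<^sub>v v) $ i = (k \<cdot>\<^sub>v v) $ i"
        using row[OF v i] i eq Suc_power[OF i] Suc_power[of 0] r by (auto simp: v_def)
    qed (simp add: v_def)
    ultimately show "eigenvalue ?A k"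
      using v by (auto simp: eigenvalue_def eigenvector_def)
  qed
qed

text \<open>Both directions rest on \<open>S_power\<close>: for real \<open>x \<ge> 1\<close>, all
  powers in the characteristic equation are at most \<open>x ^ (r - 1)\<close>, so its right-hand
  side is at most \<open>S * x ^ (r - 1)\<close>. A complex eigenvalue is reduced to its modulus by
  the triangle inequality.\<close>

lemma spectral_radius_companion_less_1_iff:
  fixes a :: "nat \<Rightarrow> real"
  assumes r: "1 \<le> r" and a: "\<And>i. 0 \<le> a i"
    and A: "A = Matrix.mat r r (\<lambda>(i, j). if i = 0 then a (Suc j) else of_bool (i = Suc j))"
  shows "spectral_radius (map_mat complex_of_real A) < 1 \<longleftrightarrow> (\<Sum>i=1..r. a i) < 1"
proof -
  let ?A = "map_mat complex_of_real A"
  have A': "?A = Matrix.mat r r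
      (\<lambda>(i, j). if i = 0 then complex_of_real (a (Suc j)) else of_bool (i = Suc j))"
    unfolding A by (rule eq_matI) auto
  have carrier: "?A \<in> carrier_mat r r" by (simp add: A)
  have ev: "eigenvalue ?A k \<longleftrightarrow> k ^ r = (\<Sum>j<r. complex_of_real (a (Suc j)) * k ^ (r - Suc j))" for k
    unfolding A' by (rule companion_eigenvalue_iff[OF r, where f="\<lambda>i. complex_of_real (a i)"])
  have sum_eq: "(\<Sum>i=1..r. a i) = (\<Sum>j<r. a (Suc j))"
    by (rule sum.reindex_bij_witness[of _ Suc "\<lambda>i. i - 1"]) auto
  define S where "S = (\<Sum>j<r. a (Suc j))"
  have S_power: "(\<Sum>j<r. a (Suc j) * x ^ (r - Suc j)) \<le> S * x ^ (r - 1)" if "1 \<le> x" for x :: real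
    unfolding S_def sum_distrib_right
    using that a by (intro sum_mono mult_left_mono power_increasing) auto
  have x_power: "x ^ r = x * x ^ (r - 1)" for x :: real
    using r by (metis One_nat_def Suc_diff_Suc Suc_le_lessD diff_zero power_Suc)
  show ?thesis
    unfolding sum_eq S_def[symmetric]
  proof
    assume less: "spectral_radius ?A < 1"
    show "S < 1"
    proof (rule ccontr)
      assume "\<not> S < 1"
      then have S: "1 \<le> S" by simp
      \<comment> \<open>The real characteristic polynomial: \<open>p 1 = 1 - S \<le> 0\<close>, and
        \<open>p S \<ge> 0\<close> by \<open>S_power\<close>, so a root lies in
        \<open>{1..S}\<close>.\<close>
      define p where "p x = x ^ r - (\<Sum>j<r. a (Suc j) * x ^ (r - Suc j))" for x :: real
      have "p 1 \<le> 0" using S by (simp add: p_def S_def)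
      moreover have "0 \<le> p S" using S_power[OF S] by (simp add: p_def x_power)
      moreover have "continuous_on {1..S} p"
        unfolding p_def by (intro continuous_intros)
      ultimately obtain x where x: "1 \<le> x" "p x = 0"
        using IVT'[of p 1 0 S] S by auto
      have "eigenvalue ?A (complex_of_real x)"
        unfolding ev using x(2) by (simp add: p_def flip: of_real_power of_real_mult of_real_sum)
      then have "norm (complex_of_real x) \<in> norm ` spectrum ?A"
        unfolding spectrum_def by blast
      from spectral_radius_mem_max(2)[OF carrier _ this] r x(1) less show False by simp
    qed
  next
    assume S: "S < 1"
    obtain k where k: "eigenvalue ?A k" "spectral_radius ?A = norm k"
      using spectral_radius_mem_max(1)[OF carrier] r unfolding spectrum_def by auto
    show "spectral_radius ?A < 1"
    proof (rule ccontr)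
      assume "\<not> spectral_radius ?A < 1"
      with k have k1: "1 \<le> norm k" by simp
      have "norm k ^ r = norm (\<Sum>j<r. complex_of_real (a (Suc j)) * k ^ (r - Suc j))"
        using k(1) ev by (metis norm_power)
      also have "\<dots> \<le> (\<Sum>j<r. a (Suc j) * norm k ^ (r - Suc j))"
        using a by (intro sum_norm_le) (simp add: norm_mult norm_power)
      also have "\<dots> \<le> S * norm k ^ (r - 1)" by (rule S_power[OF k1])
      also have "\<dots> < 1 * norm k ^ (r - 1)"
        using S k1 by (intro mult_strict_right_mono zero_less_power) linarith+
      also have "\<dots> \<le> norm k ^ r" unfolding x_power[of "norm k"]
        using k1 by (intro mult_right_mono) auto
      finally show False by simp
    qed
  qed
qed

subsection \<open>Contractive recursions\<close>

text \<open>Induction on \<open>n\<close>, with the unresolved lags in a window of length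
  \<open>r\<close>. Passing to \<open>Suc n\<close> only drops lag \<open>n\<close>; one application
  of \<open>step\<close> at time \<open>t - n\<close> either stops there or leads to a lag between
  \<open>n + 1\<close> and \<open>n + r\<close>, inside the new window.\<close>

lemma backward_iteration:
  fixes x z :: "int \<Rightarrow> ennreal"
  assumes r: "1 \<le> r"
    and step: "\<And>t. x t \<le> z t \<or> (\<exists>i\<in>{1..r}. x t \<le> k ^ i * x (t - int i))"
  shows "(\<exists>s<n. x t \<le> k ^ s * z (t - int s)) \<or> (\<exists>s\<in>{n..<n + r}. x t \<le> k ^ s * x (t - int s))"
proof (induction n)
  case 0
  have "x t \<le> k ^ 0 * x (t - int 0)" by simp
  with r show ?case by force
next
  case (Suc n)
  then consider (a) s where "s < n" "x t \<le> k ^ s * z (t - int s)"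
    | (b) s where "s \<in> {Suc n..<Suc n + r}" "x t \<le> k ^ s * x (t - int s)"
    | (c) "x t \<le> k ^ n * x (t - int n)"
    by (metis Suc_leI add_Suc atLeastLessThan_iff less_SucI nat_less_le)
  then show ?case
  proof cases
    case c
    from step[of "t - int n"] show ?thesis
    proof
      assume "x (t - int n) \<le> z (t - int n)"
      then have "x t \<le> k ^ n * z (t - int n)"
        using c by (meson mult_left_mono order_trans zero_le)
      then show ?thesis by blast
    next
      assume "\<exists>i\<in>{1..r}. x (t - int n) \<le> k ^ i * x (t - int n - int i)"
      then obtain i where i: "i \<in> {1..r}" "x (t - int n) \<le> k ^ i * x (t - int n - int i)" by blast
      have "x t \<le> k ^ n * (k ^ i * x (t - int n - int i))"
        using c i by (meson mult_left_mono order_trans zero_le)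
      also have "\<dots> = k ^ (n + i) * x (t - int (n + i))"
        by (simp add: power_add mult.assoc diff_diff_eq)
      finally show ?thesis using i(1) by (intro disjI2 bexI[of _ "n + i"]) auto
    qed
  qed (auto intro: less_SucI)
qed

text \<open>A priori \<open>X 0\<close> is only almost surely finite, so the remainder of the
  backward iteration need not have a finite mean. Truncating at \<open>K\<close> makes it vanish as
  \<open>n\<close> grows, and the resulting bound \<open>S\<close> does not depend on
  \<open>K\<close>.\<close>

lemma (in prob_space) nn_integral_contractive_recursion_finite:
  fixes X Z :: "int \<Rightarrow> 'a \<Rightarrow> ennreal"
  assumes X[measurable]: "\<And>t. X t \<in> borel_measurable M"
    and Z[measurable]: "\<And>t. Z t \<in> borel_measurable M"
    and distr_X: "\<And>t. distr M borel (X t) = distr M borel (X 0)"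
    and X_finite: "AE w in M. X 0 w < \<infinity>"
    and Z_bound: "\<And>t. (\<integral>\<^sup>+w. Z t w \<partial>M) \<le> B" "B < \<infinity>"
    and k: "0 \<le> k" "k < 1" and r: "1 \<le> r"
    and step: "AE w in M. \<forall>t. X t w \<le> Z t w \<or> (\<exists>i\<in>{1..r}. X t w \<le> ennreal k ^ i * X (t - int i) w)"
  shows "(\<integral>\<^sup>+w. X t w \<partial>M) < \<infinity>"
proof -
  \<comment> \<open>The mean of a truncated remainder term; by equality of the marginal laws it
    depends on the lag \<open>s\<close> alone.\<close>
  define g where "g K s = (\<integral>\<^sup>+w. min (ennreal k ^ s * X 0 w) (of_nat K) \<partial>M)" for K s :: nat
  define S where "S = ennreal (1 / (1 - k)) * B"
  have g_shift: "(\<integral>\<^sup>+w. min (ennreal k ^ s * X u w) (of_nat K) \<partial>M) = g K s" for K s u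
  proof -
    have "(\<integral>\<^sup>+w. min (ennreal k ^ s * X u w) (of_nat K) \<partial>M)
        = (\<integral>\<^sup>+y. min (ennreal k ^ s * y) (of_nat K) \<partial>distr M borel (X u))"
      by (subst nn_integral_distr) auto
    also have "\<dots> = g K s"
      unfolding distr_X[of u] g_def by (subst nn_integral_distr) auto
    finally show ?thesis .
  qed
  \<comment> \<open>The alternatives of \<open>backward_iteration\<close> are bounded by sums over
    all lags. The truncation is kept only on the remainder; the other terms sum to at most
    \<open>S\<close>, by the geometric series.\<close>
  have bound: "(\<integral>\<^sup>+w. min (X t w) (of_nat K) \<partial>M) \<le> S + (\<Sum>j<r. g K (n + j))" for n K
  proof -
    have "AE w in M. min (X t w) (of_nat K)
        \<le> (\<Sum>s<n. ennreal k ^ s * Z (t - int s) w)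
          + (\<Sum>s\<in>{n..<n+r}. min (ennreal k ^ s * X (t - int s) w) (of_nat K))"
      using step
    proof eventually_elim
      case (elim w)
      from backward_iteration[OF r, of "\<lambda>t. X t w" "\<lambda>t. Z t w" "ennreal k" n t] elim
      consider (a) s where "s < n" "X t w \<le> ennreal k ^ s * Z (t - int s) w"
        | (b) s where "s \<in> {n..<n+r}" "X t w \<le> ennreal k ^ s * X (t - int s) w" by blast
      then show ?case
      proof cases
        case a
        have "ennreal k ^ s * Z (t - int s) w \<le> (\<Sum>s<n. ennreal k ^ s * Z (t - int s) w)"
          using a(1) by (intro member_le_sum) auto
        then show ?thesis using a(2)
          by (meson add_increasing2 min.coboundedI1 order_trans zero_le)
      next
        case b
        have "min (X t w) (of_nat K) \<le> min (ennreal k ^ s * X (t - int s) w) (of_nat K)"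
          using b(2) by (intro min.mono) auto
        also have "\<dots> \<le> (\<Sum>s\<in>{n..<n+r}. min (ennreal k ^ s * X (t - int s) w) (of_nat K))"
          using b(1) by (intro member_le_sum) auto
        finally show ?thesis by (simp add: add_increasing)
      qed
    qed
    then have "(\<integral>\<^sup>+w. min (X t w) (of_nat K) \<partial>M)
        \<le> (\<integral>\<^sup>+w. (\<Sum>s<n. ennreal k ^ s * Z (t - int s) w)
          + (\<Sum>s\<in>{n..<n+r}. min (ennreal k ^ s * X (t - int s) w) (of_nat K)) \<partial>M)"
      by (rule nn_integral_mono_AE)
    also have "\<dots> = (\<Sum>s<n. ennreal k ^ s * (\<integral>\<^sup>+w. Z (t - int s) w \<partial>M)) + (\<Sum>s\<in>{n..<n+r}. g K s)"
      by (simp add: nn_integral_add nn_integral_sum nn_integral_cmult g_shift)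
    also have "(\<Sum>s<n. ennreal k ^ s * (\<integral>\<^sup>+w. Z (t - int s) w \<partial>M)) \<le> (\<Sum>s<n. ennreal k ^ s * B)"
      by (intro sum_mono mult_left_mono Z_bound) auto
    also have "\<dots> = ennreal (\<Sum>s<n. k ^ s) * B"
      using k by (simp add: sum_distrib_right ennreal_power flip: sum_ennreal)
    also have "\<dots> \<le> S"
    proof -
      have "(\<Sum>s<n. k ^ s) \<le> 1 / (1 - k)"
        using sum_gp_strict[of k n] k by (simp add: divide_right_mono)
      then show ?thesis unfolding S_def by (intro mult_right_mono ennreal_leI) auto
    qed
    also have "(\<Sum>s\<in>{n..<n+r}. g K s) = (\<Sum>j<r. g K (n + j))"
      by (rule sum.reindex_bij_witness[of _ "\<lambda>j. n + j" "\<lambda>s. s - n"]) auto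
    finally show ?thesis by (simp add: add_mono)
  qed
  \<comment> \<open>Dominated convergence with the constant \<open>K\<close>, integrable on a
    probability space; the pointwise limit uses that \<open>X 0\<close> is almost surely
    finite.\<close>
  have g_lim: "g K \<longlonglongrightarrow> 0" for K
  proof -
    have "(\<lambda>s. g K s) \<longlonglongrightarrow> (\<integral>\<^sup>+w. 0 \<partial>M)"
      unfolding g_def
    proof (rule nn_integral_dominated_convergence[where w="\<lambda>_. of_nat K"])
      show "AE w in M. (\<lambda>s. min (ennreal k ^ s * X 0 w) (of_nat K)) \<longlonglongrightarrow> 0"
        using X_finite
      proof eventually_elim
        case (elim w)
        then obtain y where y: "X 0 w = ennreal y" "0 \<le> y" by (cases "X 0 w") auto
        have "(\<lambda>s. k ^ s * y) \<longlonglongrightarrow> 0 * y"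
          using k by (intro tendsto_intros LIMSEQ_power_zero) auto
        then have "(\<lambda>s. ennreal (k ^ s * y)) \<longlonglongrightarrow> ennreal (0 * y)"
          by (rule tendsto_ennrealI)
        then have "(\<lambda>s. ennreal k ^ s * X 0 w) \<longlonglongrightarrow> 0"
          using k y by (simp add: ennreal_power ennreal_mult)
        then show ?case
          by (rule tendsto_sandwich[OF _ _ tendsto_const, rotated 2]) auto
      qed
      show "(\<integral>\<^sup>+w. of_nat K \<partial>M) < \<infinity>"
        by (simp add: emeasure_space_1 of_nat_less_top)
    qed auto
    then show ?thesis by simp
  qed
  have min_le: "(\<integral>\<^sup>+w. min (X t w) (of_nat K) \<partial>M) \<le> S" for K
  proof (rule LIMSEQ_le_const)
    have "(\<lambda>n. S + (\<Sum>j<r. g K (n + j))) \<longlonglongrightarrow> S + (\<Sum>j<r. 0)"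
      by (intro tendsto_intros LIMSEQ_ignore_initial_segment g_lim)
    then show "(\<lambda>n. S + (\<Sum>j<r. g K (n + j))) \<longlonglongrightarrow> S" by simp
  qed (use bound in blast)
  \<comment> \<open>Prepares the removal of the truncation by monotone convergence in
    \<open>K\<close>.\<close>
  have sup: "(SUP K. min x (of_nat K)) = x" for x :: ennreal
  proof -
    have "(SUP K. min x (of_nat K)) = min x (SUP K. of_nat K)"
      by (metis (no_types, lifting) inf_min SUP_cong inf_SUP)
    then show ?thesis by (simp add: ennreal_SUP_of_nat_eq_top)
  qed
  have "(\<integral>\<^sup>+w. X t w \<partial>M) = (\<integral>\<^sup>+w. (SUP K. min (X t w) (of_nat K)) \<partial>M)"
    by (simp add: sup)
  also have "\<dots> = (SUP K. \<integral>\<^sup>+w. min (X t w) (of_nat K) \<partial>M)"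
    by (intro nn_integral_monotone_convergence_SUP)
       (auto simp: incseq_def le_fun_def intro!: min.coboundedI2 of_nat_mono)
  also have "\<dots> \<le> S" by (intro SUP_least min_le)
  also have "S < \<infinity>" unfolding S_def using Z_bound(2) by (simp add: ennreal_mult_less_top)
  finally show ?thesis .
qed

text \<open>If every alternative failed, then \<open>x i \<le> x0 / l ^ r\<close> for all
  \<open>i\<close>, so the sum would be at most \<open>c * x0\<close>, while
  \<open>z < (1 - c) * x0\<close>; adding the two contradicts the assumed bound on
  \<open>x0\<close>.\<close>

lemma contractive_dichotomy:
  fixes a :: "nat \<Rightarrow> real"
  assumes r: "1 \<le> r" and a: "\<And>i. 0 \<le> a i" and S: "(\<Sum>i=1..r. a i) < 1"
  obtains l d where "0 < l" "l < 1" "0 < d"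
    and "\<And>x0 x z. 0 \<le> x0 \<Longrightarrow> x0 \<le> (\<Sum>i=1..r. a i * x i) + z \<Longrightarrow>
           x0 \<le> d * z \<or> (\<exists>i\<in>{1..r}. x0 \<le> l ^ i * x i)"
proof -
  define S where "S = (\<Sum>i=1..r. a i)"
  have S01: "0 \<le> S" "S < 1" using a S by (auto simp: S_def intro!: sum_nonneg)
  \<comment> \<open>\<open>l ^ r\<close> is the midpoint of \<open>S\<close> and 1: above
    \<open>S\<close>, so that \<open>c < 1\<close>, and positive even for
    \<open>S = 0\<close>.\<close>
  define l where "l = root r ((1 + S) / 2)"
  have l: "0 < l" "l < 1" "l ^ r = (1 + S) / 2"
    using r S01 by (auto simp: l_def)
  define c where "c = S / l ^ r"
  have c: "c < 1" using S01 l by (simp add: c_def)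
  show thesis
  proof (rule that[of l "1 / (1 - c)"])
    fix x0 z :: real and x :: "nat \<Rightarrow> real"
    assume x0: "0 \<le> x0" and le: "x0 \<le> (\<Sum>i=1..r. a i * x i) + z"
    show "x0 \<le> 1 / (1 - c) * z \<or> (\<exists>i\<in>{1..r}. x0 \<le> l ^ i * x i)"
    proof (rule ccontr)
      assume "\<not> ?thesis"
      then have z: "z < (1 - c) * x0" and xi: "\<And>i. i \<in> {1..r} \<Longrightarrow> l ^ i * x i < x0"
        using c by (auto simp: field_simps not_le)
      have "(\<Sum>i=1..r. a i * x i) \<le> (\<Sum>i=1..r. a i * (x0 / l ^ r))"
      proof (intro sum_mono mult_left_mono a)
        fix i assume i: "i \<in> {1..r}"
        have "x i \<le> x0 / l ^ i" using xi[OF i] l by (simp add: field_simps)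
        also have "\<dots> \<le> x0 / l ^ r"
          using i l x0 by (intro divide_left_mono power_decreasing) auto
        finally show "x i \<le> x0 / l ^ r" .
      qed
      also have "\<dots> = c * x0" unfolding c_def S_def by (subst sum_distrib_right[symmetric]) simp
      finally show False using z le by (simp add: algebra_simps)
    qed
  qed (use l c in auto)
qed

text \<open>The sum is at most \<open>card I\<close> times its largest term. This crude constant
  serves \<open>m < 1\<close> and \<open>m \<ge> 1\<close> alike.\<close>

lemma sum_powr_le:
  fixes u :: "'i \<Rightarrow> real"
  assumes I: "finite I" and u: "\<And>i. i \<in> I \<Longrightarrow> 0 \<le> u i" and m: "0 < m"
  shows "(\<Sum>i\<in>I. u i) powr m \<le> real (card I) powr m * (\<Sum>i\<in>I. u i powr m)"
proof (cases "I = {}")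
  case False
  then have "Max (u ` I) \<in> u ` I" using I by (intro Max_in) auto
  then obtain j where j: "j \<in> I" "u j = Max (u ` I)" by auto
  have "(\<Sum>i\<in>I. u i) \<le> real (card I) * u j"
    using I j(2) by (intro sum_bounded_above) auto
  then have "(\<Sum>i\<in>I. u i) powr m \<le> (real (card I) * u j) powr m"
    using u m by (intro powr_mono2) (auto intro!: sum_nonneg)
  also have "\<dots> = real (card I) powr m * u j powr m"
    using u j by (simp add: powr_mult)
  also have "\<dots> \<le> real (card I) powr m * (\<Sum>i\<in>I. u i powr m)"
    using I j by (intro mult_left_mono member_le_sum) auto
  finally show ?thesis .
qed simp

subsection \<open>The log-GARCH model\<close>

lemma sum_trunc_coef:
  assumes "n \<le> r"
  shows "(\<Sum>i=1..r. trunc_coef n a i * f i) = (\<Sum>i=1..n. a i * f i)"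
proof -
  have "(\<Sum>i=1..n. trunc_coef n a i * f i) = (\<Sum>i=1..r. trunc_coef n a i * f i)"
    using assms by (intro sum.mono_neutral_left) (auto simp: trunc_coef_def)
  then show ?thesis by (simp add: trunc_coef_def)
qed

section \<open>The coefficients \<open>mu_coef\<close> and their essential suprema\<close>

lemma mu_coef_pos: "0 < x \<Longrightarrow> mu_coef p q ap am b i x = trunc_coef q ap i + trunc_coef p b i"
  and mu_coef_neg: "x < 0 \<Longrightarrow> mu_coef p q ap am b i x = trunc_coef q am i + trunc_coef p b i"
  by (simp_all add: mu_coef_def)

lemma abs_mu_coef_le:
  assumes "x \<noteq> 0"
  shows "\<bar>mu_coef p q ap am b i x\<bar>
    \<le> max \<bar>trunc_coef q ap i + trunc_coef p b i\<bar> \<bar>trunc_coef q am i + trunc_coef p b i\<bar>"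
  using assms by (cases "x > 0") (auto simp: mu_coef_def)

lemma measurable_mu_coef [measurable]: "mu_coef p q ap am b i \<in> borel_measurable borel"
proof -
  have "mu_coef p q ap am b i = (\<lambda>x. trunc_coef q ap i * indicator {0<..} x
      + trunc_coef q am i * indicator {..<0} x + trunc_coef p b i)"
    by (auto simp: mu_coef_def indicator_def)
  then show ?thesis by simp
qed

text \<open>Off a null set \<open>mu_coef\<close> takes one value for each sign of \<open>Y\<close>,
  and both signs have positive probability. An essential supremum below one of the two absolute
  values would exclude the corresponding sign.\<close>

lemma (in prob_space) esssup_abs_mu_coef:
  assumes Y[measurable]: "Y \<in> borel_measurable M"
    and nonzero: "AE w in M. Y w \<noteq> 0"
    and signs: "\<not> (AE w in M. Y w \<le> 0)" "\<not> (AE w in M. 0 \<le> Y w)"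
  shows "esssup M (\<lambda>w. ereal \<bar>mu_coef p q ap am b i (Y w)\<bar>)
    = ereal (max \<bar>trunc_coef q ap i + trunc_coef p b i\<bar> \<bar>trunc_coef q am i + trunc_coef p b i\<bar>)"
    (is "?e = ereal (max ?x ?y)")
proof (rule antisym)
  have "AE w in M. ereal \<bar>mu_coef p q ap am b i (Y w)\<bar> \<le> ereal (max ?x ?y)"
    using nonzero by eventually_elim (use abs_mu_coef_le in \<open>simp only: ereal_less_eq\<close>)
  then show "?e \<le> ereal (max ?x ?y)" by (intro esssup_I) measurable
  have le: "AE w in M. ereal \<bar>mu_coef p q ap am b i (Y w)\<bar> \<le> ?e" by (rule esssup_AE)
  have "ereal ?x \<le> ?e"
  proof (rule ccontr)
    assume less: "\<not> ereal ?x \<le> ?e"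
    have "AE w in M. Y w \<le> 0"
      using le
    proof eventually_elim
      case (elim w)
      with less show ?case by (cases "Y w \<le> 0") (auto simp: mu_coef_pos mu_coef_neg not_le)
    qed
    with signs show False by blast
  qed
  moreover have "ereal ?y \<le> ?e"
  proof (rule ccontr)
    assume less: "\<not> ereal ?y \<le> ?e"
    have "AE w in M. 0 \<le> Y w"
      using le
    proof eventually_elim
      case (elim w)
      with less show ?case by (cases "0 \<le> Y w") (auto simp: mu_coef_pos mu_coef_neg not_le)
    qed
    with signs show False by blast
  qed
  ultimately show "ereal (max ?x ?y) \<le> ?e" by (simp add: max_def)
qed

section \<open>Marginal laws and signs of the innovations, and the matrix
  \<open>A_inf\<close>\<close>

lemma (in prob_space) iid_innovations_measurable:
  "iid_innovations M \<eta> \<Longrightarrow> \<eta> t \<in> borel_measurable M"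
  unfolding iid_innovations_def indep_vars_def by auto

lemma (in prob_space) iid_innovations_nn_integral:
  assumes \<eta>: "iid_innovations M \<eta>" and [measurable]: "h \<in> borel_measurable borel"
  shows "(\<integral>\<^sup>+w. h (\<eta> t w) \<partial>M) = (\<integral>\<^sup>+w. h (\<eta> 0 w) \<partial>M)"
proof -
  note [measurable] = iid_innovations_measurable[OF \<eta>]
  have "(\<integral>\<^sup>+w. h (\<eta> t w) \<partial>M) = (\<integral>\<^sup>+y. h y \<partial>distr M borel (\<eta> t))"
    by (simp add: nn_integral_distr)
  also have "distr M borel (\<eta> t) = distr M borel (\<eta> 0)"
    using \<eta> unfolding iid_innovations_def by blast
  also have "(\<integral>\<^sup>+y. h y \<partial>distr M borel (\<eta> 0)) = (\<integral>\<^sup>+w. h (\<eta> 0 w) \<partial>M)"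
    by (simp add: nn_integral_distr)
  finally show ?thesis .
qed

lemma (in prob_space) iid_innovations_AE:
  assumes \<eta>: "iid_innovations M \<eta>" and [measurable]: "Measurable.pred borel P"
  shows "(AE w in M. P (\<eta> t w)) \<longleftrightarrow> (AE w in M. P (\<eta> 0 w))"
proof -
  note [measurable] = iid_innovations_measurable[OF \<eta>]
  have "distr M borel (\<eta> t) = distr M borel (\<eta> 0)"
    using \<eta> unfolding iid_innovations_def by blast
  moreover have "(AE w in M. P (\<eta> s w)) \<longleftrightarrow> (AE y in distr M borel (\<eta> s). P y)" for s
    by (subst AE_distr_iff) auto
  ultimately show ?thesis by metis
qed

text \<open>A centred variable of almost surely constant weak sign vanishes almost surely, which
  \<open>nonzero\<close> excludes.\<close>

lemma (in prob_space) iid_innovations_signs: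
  assumes \<eta>: "iid_innovations M \<eta>" and nonzero: "AE w in M. \<eta> 0 w \<noteq> 0"
  shows "\<not> (AE w in M. \<eta> t w \<le> 0)" "\<not> (AE w in M. 0 \<le> \<eta> t w)"
proof -
  have int: "integrable M (\<eta> 0)" "(\<integral>w. \<eta> 0 w \<partial>M) = 0"
    using \<eta> unfolding iid_innovations_def has_bochner_integral_iff by auto
  have nz: "\<not> (AE w in M. \<eta> 0 w = 0)"
  proof
    assume "AE w in M. \<eta> 0 w = 0"
    with nonzero have "AE w in M. False" by eventually_elim simp
    then show False by simp
  qed
  have "\<not> (AE w in M. 0 \<le> \<eta> 0 w)"
    using integral_nonneg_eq_0_iff_AE[OF int(1)] int(2) nz by blast
  moreover have "\<not> (AE w in M. \<eta> 0 w \<le> 0)"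
    using integral_nonneg_eq_0_iff_AE[of M "\<lambda>w. - \<eta> 0 w"] int nz by auto
  ultimately show "\<not> (AE w in M. \<eta> t w \<le> 0)" "\<not> (AE w in M. 0 \<le> \<eta> t w)"
    using iid_innovations_AE[OF \<eta>, of "\<lambda>x. x \<le> 0" t] iid_innovations_AE[OF \<eta>, of "\<lambda>x. 0 \<le> x" t]
    by simp_all
qed

lemma (in prob_space) AE_nonzero_of_log_plus_moment:
  assumes [measurable]: "Y \<in> borel_measurable M" and fin: "log_plus_abs_log_moment M Y < \<infinity>"
  shows "AE w in M. Y w \<noteq> 0"
proof -
  have "AE w in M. (if Y w = 0 then \<infinity> else ennreal (max 0 (ln \<bar>ln ((Y w)\<^sup>2)\<bar>))) \<noteq> \<infinity>"
    using fin unfolding log_plus_abs_log_moment_def by (intro nn_integral_PInf_AE) auto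
  then show ?thesis by eventually_elim (auto split: if_splits)
qed

text \<open>Identifies \<open>A_inf\<close> as a companion matrix, to which the spectral criterion
  applies. Each first-row entry involves a single innovation, so only the marginal law matters; the
  other rows are constant.\<close>

lemma (in prob_space) A_inf_eq:
  assumes \<eta>: "iid_innovations M \<eta>" and nonzero: "AE w in M. \<eta> 0 w \<noteq> 0"
  shows "A_inf p q ap am b M \<eta> = Matrix.mat (max p q) (max p q) (\<lambda>(i, j).
     if i = 0 then max \<bar>trunc_coef q ap (Suc j) + trunc_coef p b (Suc j)\<bar>
                       \<bar>trunc_coef q am (Suc j) + trunc_coef p b (Suc j)\<bar>
     else of_bool (i = Suc j))"
proof -
  have nz: "AE w in M. \<eta> t w \<noteq> 0" for t
    using iid_innovations_AE[OF \<eta>, of "\<lambda>x. x \<noteq> 0" t] nonzero by simp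
  have entry: "A_inf p q ap am b M \<eta> $$ (i, j) = (if i = 0
      then max \<bar>trunc_coef q ap (Suc j) + trunc_coef p b (Suc j)\<bar>
               \<bar>trunc_coef q am (Suc j) + trunc_coef p b (Suc j)\<bar>
      else of_bool (i = Suc j))"
    if ij: "i < max p q" "j < max p q" for i j
  proof (cases "i = 0")
    case True
    have "A_inf p q ap am b M \<eta> $$ (i, j) = real_of_ereal
        (esssup M (\<lambda>w. ereal \<bar>mu_coef p q ap am b (Suc j) (\<eta> (1 - int (Suc j)) w)\<bar>))"
      using ij True by (simp add: A_inf_def A_mat_def)
    then show ?thesis using True
      by (simp only: esssup_abs_mu_coef[OF iid_innovations_measurable[OF \<eta>] nz
            iid_innovations_signs[OF \<eta> nonzero]] real_of_ereal.simps(1)) simp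
  next
    case False
    then show ?thesis
      using ij by (simp add: A_inf_def A_mat_def esssup_const emeasure_space_1)
  qed
  show ?thesis by (rule eq_matI) (simp add: entry, simp_all add: A_inf_def)
qed

section \<open>Moments of the stationary solution\<close>

lemma strictly_stationary_distr:
  assumes X: "strictly_stationary M X" and f[measurable]: "f \<in> borel_measurable borel"
  shows "distr M borel (\<lambda>w. f (X t w)) = distr M borel (\<lambda>w. f (X 0 w))"
proof -
  have [measurable]: "X t \<in> borel_measurable M" for t
    using X unfolding strictly_stationary_def by blast
  have [measurable]: "(\<lambda>w s. X (s + h) w) \<in> M \<rightarrow>\<^sub>M (\<Pi>\<^sub>M s\<in>UNIV. borel)" for h
    by (rule measurable_abs_UNIV) measurable
  have [measurable]: "(\<lambda>x. x 0) \<in> (\<Pi>\<^sub>M s\<in>(UNIV::int set). borel) \<rightarrow>\<^sub>M borel"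
    by (rule measurable_component_singleton) simp
  \<comment> \<open>Each marginal is the law of a shifted path evaluated at time 0, and the path
    laws agree by stationarity.\<close>
  have "distr M borel (\<lambda>w. f (X h w))
      = distr (distr M (\<Pi>\<^sub>M s\<in>UNIV. borel) (\<lambda>w s. X (s + h) w)) borel (\<lambda>x. f (x 0))" for h
    by (subst distr_distr) (auto simp: comp_def)
  moreover have "distr M (\<Pi>\<^sub>M s\<in>UNIV. borel) (\<lambda>w s. X (s + t) w)
      = distr M (\<Pi>\<^sub>M s\<in>UNIV. borel) (\<lambda>w s. X (s + 0) w)"
    using X unfolding strictly_stationary_def by simp
  ultimately show ?thesis by metis
qed

text \<open>Since \<open>e\<close> and \<open>h\<close> have the same sign and
  \<open>ln (e\<^sup>2) = ln (s\<^sup>2) + ln (h\<^sup>2)\<close>, the ARCH and GARCH coefficients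
  act on the same log-volatilities. Grouping them into \<open>mu_coef\<close> before taking absolute
  values is what yields \<bar>\<alpha> + \<beta>\<bar> instead of \<bar>\<alpha>\<bar> +
  \<bar>\<beta>\<bar>.\<close>

lemma log_garch_abs_log_volatility_le:
  fixes e s h :: "int \<Rightarrow> real"
  assumes s: "\<And>u. 0 < s u" and e: "\<And>u. e u = s u * h u" and h: "\<And>u. h u \<noteq> 0"
    and eq: "ln ((s t)\<^sup>2) = \<omega>
      + (\<Sum>i=1..q. (ap i * of_bool (e (t - int i) > 0) + am i * of_bool (e (t - int i) < 0))
                    * ln ((e (t - int i))\<^sup>2))
      + (\<Sum>j=1..p. b j * ln ((s (t - int j))\<^sup>2))"
  shows "\<bar>ln ((s t)\<^sup>2)\<bar> \<le>
      (\<Sum>i=1..max p q. max \<bar>trunc_coef q ap i + trunc_coef p b i\<bar> \<bar>trunc_coef q am i + trunc_coef p b i\<bar>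
          * \<bar>ln ((s (t - int i))\<^sup>2)\<bar>)
      + (\<bar>\<omega>\<bar> + (\<Sum>i=1..q. (\<bar>ap i\<bar> + \<bar>am i\<bar>) * \<bar>ln ((h (t - int i))\<^sup>2)\<bar>))"
proof -
  define L where "L u = ln ((s u)\<^sup>2)" for u
  define H where "H u = ln ((h u)\<^sup>2)" for u
  define c where "c i = ap i * of_bool (h (t - int i) > 0) + am i * of_bool (h (t - int i) < 0)" for i
  have sign: "e u > 0 \<longleftrightarrow> h u > 0" "e u < 0 \<longleftrightarrow> h u < 0" for u
    using s[of u] by (simp_all add: e zero_less_mult_iff mult_less_0_iff)
  have ln_e: "ln ((e u)\<^sup>2) = L u + H u" for u
    using s[of u] h[of u] by (simp add: e L_def H_def power_mult_distrib ln_mult)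
  \<comment> \<open>Padding the coefficients by zero up to \<open>max p q\<close> merges the sums of
    lengths \<open>q\<close> and \<open>p\<close>.\<close>
  have mu: "(\<Sum>i=1..max p q. mu_coef p q ap am b i (h (t - int i)) * L (t - int i))
      = (\<Sum>i=1..q. c i * L (t - int i)) + (\<Sum>i=1..p. b i * L (t - int i))"
  proof -
    have "(\<Sum>i=1..max p q. mu_coef p q ap am b i (h (t - int i)) * L (t - int i))
      = (\<Sum>i=1..max p q. trunc_coef q ap i * (of_bool (h (t - int i) > 0) * L (t - int i)))
      + (\<Sum>i=1..max p q. trunc_coef q am i * (of_bool (h (t - int i) < 0) * L (t - int i)))
      + (\<Sum>i=1..max p q. trunc_coef p b i * L (t - int i))"
      unfolding mu_coef_def by (simp only: sum.distrib[symmetric]) (simp add: algebra_simps)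
    then show ?thesis
      by (simp only: sum_trunc_coef[OF max.cobounded1] sum_trunc_coef[OF max.cobounded2] c_def
            sum.distrib[symmetric] distrib_right mult.assoc)
  qed
  have "L t = \<omega> + (\<Sum>i=1..q. c i * (L (t - int i) + H (t - int i))) + (\<Sum>i=1..p. b i * L (t - int i))"
    using eq unfolding sign ln_e by (simp add: L_def c_def)
  also have "\<dots> = \<omega> + (\<Sum>i=1..max p q. mu_coef p q ap am b i (h (t - int i)) * L (t - int i))
      + (\<Sum>i=1..q. c i * H (t - int i))"
    unfolding mu by (simp add: distrib_left sum.distrib)
  finally have "\<bar>L t\<bar> \<le> \<bar>\<omega>\<bar> + \<bar>\<Sum>i=1..max p q. mu_coef p q ap am b i (h (t - int i)) * L (t - int i)\<bar>
      + \<bar>\<Sum>i=1..q. c i * H (t - int i)\<bar>" by linarith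
  moreover have "\<bar>\<Sum>i=1..max p q. mu_coef p q ap am b i (h (t - int i)) * L (t - int i)\<bar>
      \<le> (\<Sum>i=1..max p q. max \<bar>trunc_coef q ap i + trunc_coef p b i\<bar> \<bar>trunc_coef q am i + trunc_coef p b i\<bar>
          * \<bar>L (t - int i)\<bar>)"
    by (intro order_trans[OF sum_abs] sum_mono, unfold abs_mult) (intro mult_right_mono abs_mu_coef_le h abs_ge_zero)
  moreover have "\<bar>\<Sum>i=1..q. c i * H (t - int i)\<bar> \<le> (\<Sum>i=1..q. (\<bar>ap i\<bar> + \<bar>am i\<bar>) * \<bar>H (t - int i)\<bar>)"
  proof (intro order_trans[OF sum_abs] sum_mono)
    fix i
    have "\<bar>c i\<bar> \<le> \<bar>ap i\<bar> + \<bar>am i\<bar>" by (auto simp: c_def)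
    then show "\<bar>c i * H (t - int i)\<bar> \<le> (\<bar>ap i\<bar> + \<bar>am i\<bar>) * \<bar>H (t - int i)\<bar>"
      unfolding abs_mult by (intro mult_right_mono) auto
  qed
  ultimately show ?thesis unfolding L_def H_def by linarith
qed

lemma (in prob_space) log_garch_abs_log_moment_finite:
  assumes r: "1 \<le> max p q"
    and \<eta>: "iid_innovations M \<eta>"
    and nonzero: "AE w in M. \<eta> 0 w \<noteq> 0"
    and contraction: "(\<Sum>i=1..max p q. max \<bar>trunc_coef q ap i + trunc_coef p b i\<bar>
                                          \<bar>trunc_coef q am i + trunc_coef p b i\<bar>) < 1"
    and solution: "stationary_log_garch_solution p q \<omega> ap am b M \<eta> \<epsilon> \<sigma>"
    and m: "0 < m" and fin: "abs_log_moment M (\<eta> 0) m < \<infinity>"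
  shows "abs_log_moment M (\<epsilon> t) m < \<infinity>"
proof -
  define L where "L u w = \<bar>ln ((\<sigma> u w)\<^sup>2)\<bar>" for u w
  define H where "H u w = \<bar>ln ((\<eta> u w)\<^sup>2)\<bar>" for u w
  define a where "a i = max \<bar>trunc_coef q ap i + trunc_coef p b i\<bar> \<bar>trunc_coef q am i + trunc_coef p b i\<bar>" for i
  have stationary: "strictly_stationary M (\<lambda>t w. (\<epsilon> t w, \<sigma> t w))"
    and equations: "log_garch_equations p q \<omega> ap am b M \<eta> \<epsilon> \<sigma>"
    using solution unfolding stationary_log_garch_solution_def by auto
  have [measurable]: "\<eta> u \<in> borel_measurable M" for u
    by (rule iid_innovations_measurable[OF \<eta>])
  have pair[measurable]: "(\<lambda>w. (\<epsilon> u w, \<sigma> u w)) \<in> borel_measurable M" for u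
    using stationary unfolding strictly_stationary_def by blast
  have [measurable]: "fst \<in> borel_measurable (borel :: (real \<times> real) measure)"
    "snd \<in> borel_measurable (borel :: (real \<times> real) measure)"
    by (intro borel_measurable_continuous_onI continuous_intros)+
  have [measurable]: "\<epsilon> u \<in> borel_measurable M" "\<sigma> u \<in> borel_measurable M" for u
    using measurable_compose[OF pair, where g=fst] measurable_compose[OF pair, where g=snd] by simp_all
  have [measurable]: "L u \<in> borel_measurable M" "H u \<in> borel_measurable M" for u
    unfolding L_def H_def by measurable

  \<comment> \<open>There are countably many times, so one null set serves them all; backward
    iteration along a path requires this.\<close>
  have AE_all: "AE w in M. \<forall>u. \<eta> u w \<noteq> 0 \<and> 0 < \<sigma> u w \<and> \<epsilon> u w = \<sigma> u w * \<eta> u w \<and>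
      L u w \<le> (\<Sum>i=1..max p q. a i * L (u - int i) w)
        + (\<bar>\<omega>\<bar> + (\<Sum>i=1..q. (\<bar>ap i\<bar> + \<bar>am i\<bar>) * H (u - int i) w))"
  proof -
    have "AE w in M. \<forall>u. \<eta> u w \<noteq> 0"
      using iid_innovations_AE[OF \<eta>, of "\<lambda>x. x \<noteq> 0"] nonzero by (simp add: AE_all_countable)
    moreover have "AE w in M. \<forall>u. \<sigma> u w > 0 \<and> \<epsilon> u w = \<sigma> u w * \<eta> u w \<and> ln ((\<sigma> u w)\<^sup>2) = \<omega>
      + (\<Sum>i=1..q. (ap i * of_bool (\<epsilon> (u - int i) w > 0) + am i * of_bool (\<epsilon> (u - int i) w < 0))
                    * ln ((\<epsilon> (u - int i) w)\<^sup>2))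
      + (\<Sum>j=1..p. b j * ln ((\<sigma> (u - int j) w)\<^sup>2))"
      using equations unfolding log_garch_equations_def AE_all_countable by blast
    ultimately show ?thesis
    proof eventually_elim
      case (elim w)
      show ?case
      proof
        fix u
        have "L u w \<le> (\<Sum>i=1..max p q. a i * L (u - int i) w)
          + (\<bar>\<omega>\<bar> + (\<Sum>i=1..q. (\<bar>ap i\<bar> + \<bar>am i\<bar>) * H (u - int i) w))"
          unfolding L_def H_def a_def
          by (rule log_garch_abs_log_volatility_le[where e="\<lambda>u. \<epsilon> u w" and s="\<lambda>u. \<sigma> u w" and h="\<lambda>u. \<eta> u w"])
             (use elim in blast)+
        with elim show "\<eta> u w \<noteq> 0 \<and> 0 < \<sigma> u w \<and> \<epsilon> u w = \<sigma> u w * \<eta> u w \<and>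
          L u w \<le> (\<Sum>i=1..max p q. a i * L (u - int i) w)
            + (\<bar>\<omega>\<bar> + (\<Sum>i=1..q. (\<bar>ap i\<bar> + \<bar>am i\<bar>) * H (u - int i) w))" by blast
      qed
    qed
  qed

  have a: "\<And>i. 0 \<le> a i" by (simp add: a_def le_max_iff_disj)
  from contractive_dichotomy[OF r a contraction[folded a_def]]
  obtain l d where l: "0 < l" "l < 1" and d: "0 < d"
    and dichotomy: "\<And>x0 x z. 0 \<le> x0 \<Longrightarrow> x0 \<le> (\<Sum>i=1..max p q. a i * x i) + z \<Longrightarrow>
           x0 \<le> d * z \<or> (\<exists>i\<in>{1..max p q}. x0 \<le> l ^ i * x i)" by blast

  \<comment> \<open>The summands of \<open>d\<close> times the noise term, with index 0 for the
    constant, so that \<open>sum_powr_le\<close> handles all \<open>q + 1\<close> of them at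
    once.\<close>
  define \<phi> where "\<phi> i u w = (if i = 0 then d * \<bar>\<omega>\<bar> else d * (\<bar>ap i\<bar> + \<bar>am i\<bar>) * H (u - int i) w)"
    for i u w
  define Z where "Z u w = ennreal ((\<Sum>i=0..q. \<phi> i u w) powr m)" for u w
  define X where "X u w = ennreal (L u w powr m)" for u w
  have \<phi>_nonneg: "0 \<le> \<phi> i u w" for i u w using d by (simp add: \<phi>_def H_def)
  have [measurable]: "\<phi> i u \<in> borel_measurable M" for i u
    by (cases "i = 0") (simp_all add: \<phi>_def[abs_def])
  have [measurable]: "X u \<in> borel_measurable M" "Z u \<in> borel_measurable M" for u
    unfolding X_def Z_def by measurable

  \<comment> \<open>Only an inequality is claimed: where the innovation is 0, \<open>H\<close> uses
    \<open>ln 0 = 0\<close>, whereas \<open>abs_log_moment\<close> counts infinity.\<close>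
  have H_moment: "(\<integral>\<^sup>+w. ennreal (H u w powr m) \<partial>M) \<le> abs_log_moment M (\<eta> 0) m" for u
  proof -
    have "(\<integral>\<^sup>+w. ennreal (H u w powr m) \<partial>M) = (\<integral>\<^sup>+w. ennreal (H 0 w powr m) \<partial>M)"
      unfolding H_def
      using iid_innovations_nn_integral[OF \<eta>, of "\<lambda>x. ennreal (\<bar>ln (x\<^sup>2)\<bar> powr m)" u] by simp
    also have "\<dots> \<le> abs_log_moment M (\<eta> 0) m"
      unfolding abs_log_moment_def H_def by (intro nn_integral_mono) auto
    finally show ?thesis .
  qed

  \<comment> \<open>The time-independent bound obtained from \<open>sum_powr_le\<close> and the
    identical laws of the innovations.\<close>
  define B where "B = ennreal (real (card {0..q}) powr m) * (\<Sum>i=0..q. if i = 0 then ennreal ((d * \<bar>\<omega>\<bar>) powr m)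
     else ennreal ((d * (\<bar>ap i\<bar> + \<bar>am i\<bar>)) powr m) * abs_log_moment M (\<eta> 0) m)"
  have Z_bound: "(\<integral>\<^sup>+w. Z u w \<partial>M) \<le> B" for u
  proof -
    have "(\<integral>\<^sup>+w. Z u w \<partial>M)
        \<le> (\<integral>\<^sup>+w. ennreal (real (card {0..q}) powr m) * (\<Sum>i=0..q. ennreal (\<phi> i u w powr m)) \<partial>M)"
    proof (rule nn_integral_mono)
      fix w
      have "Z u w \<le> ennreal (real (card {0..q}) powr m * (\<Sum>i=0..q. \<phi> i u w powr m))"
        unfolding Z_def by (intro ennreal_leI sum_powr_le m \<phi>_nonneg) simp
      then show "Z u w \<le> ennreal (real (card {0..q}) powr m) * (\<Sum>i=0..q. ennreal (\<phi> i u w powr m))"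
        by (simp add: ennreal_mult sum_nonneg sum_ennreal)
    qed
    also have "\<dots> = ennreal (real (card {0..q}) powr m) * (\<Sum>i=0..q. \<integral>\<^sup>+w. ennreal (\<phi> i u w powr m) \<partial>M)"
      by (simp add: nn_integral_cmult nn_integral_sum del: sum_ennreal)
    also have "\<dots> \<le> B"
      unfolding B_def
    proof (intro mult_left_mono sum_mono)
      fix i
      show "(\<integral>\<^sup>+w. ennreal (\<phi> i u w powr m) \<partial>M) \<le> (if i = 0 then ennreal ((d * \<bar>\<omega>\<bar>) powr m)
          else ennreal ((d * (\<bar>ap i\<bar> + \<bar>am i\<bar>)) powr m) * abs_log_moment M (\<eta> 0) m)"
      proof (cases "i = 0")
        case True
        then show ?thesis by (simp add: \<phi>_def emeasure_space_1)
      next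
        case False
        have "(\<integral>\<^sup>+w. ennreal (\<phi> i u w powr m) \<partial>M)
            = (\<integral>\<^sup>+w. ennreal ((d * (\<bar>ap i\<bar> + \<bar>am i\<bar>)) powr m) * ennreal (H (u - int i) w powr m) \<partial>M)"
          using False d by (simp add: \<phi>_def powr_mult ennreal_mult H_def)
        also have "\<dots> = ennreal ((d * (\<bar>ap i\<bar> + \<bar>am i\<bar>)) powr m) * (\<integral>\<^sup>+w. ennreal (H (u - int i) w powr m) \<partial>M)"
          by (rule nn_integral_cmult) measurable
        finally show ?thesis using False H_moment by (simp add: mult_left_mono)
      qed
    qed simp
    finally show ?thesis .
  qed
  have B: "B < \<infinity>"
    unfolding B_def using fin by (auto simp: ennreal_mult_less_top)

  \<comment> \<open>Raising the dichotomy to the power \<open>m\<close> turns the factor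
    \<open>l ^ i\<close> into \<open>(l powr m) ^ i\<close>, hence the rate
    \<open>l powr m\<close>.\<close>
  have X_finite: "(\<integral>\<^sup>+w. X t w \<partial>M) < \<infinity>"
  proof (rule nn_integral_contractive_recursion_finite[where Z=Z and B=B and k="l powr m" and r="max p q"])
    show "distr M borel (X u) = distr M borel (X 0)" for u
      using strictly_stationary_distr[OF stationary,
          of "\<lambda>y. ennreal (\<bar>ln ((snd y)\<^sup>2)\<bar> powr m)" u]
      by (simp add: X_def[abs_def] L_def)
    show "AE w in M. \<forall>u. X u w \<le> Z u w \<or> (\<exists>i\<in>{1..max p q}. X u w \<le> ennreal (l powr m) ^ i * X (u - int i) w)"
      using AE_all
    proof eventually_elim
      case (elim w)
      show ?case
      proof
        fix u
        let ?z = "\<bar>\<omega>\<bar> + (\<Sum>i=1..q. (\<bar>ap i\<bar> + \<bar>am i\<bar>) * H (u - int i) w)"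
        have z: "d * ?z = (\<Sum>i=0..q. \<phi> i u w)"
          by (simp add: sum.atLeast_Suc_atMost[of 0 q] \<phi>_def ring_distribs sum_distrib_left mult.assoc)
        have L: "0 \<le> L v w" for v by (simp add: L_def)
        from dichotomy[OF L, of u "\<lambda>i. L (u - int i) w" ?z] elim
        consider "L u w \<le> d * ?z" | i where "i \<in> {1..max p q}" "L u w \<le> l ^ i * L (u - int i) w"
          by blast
        then show "X u w \<le> Z u w \<or> (\<exists>i\<in>{1..max p q}. X u w \<le> ennreal (l powr m) ^ i * X (u - int i) w)"
        proof cases
          case 1
          then have "X u w \<le> Z u w"
            unfolding X_def Z_def z using m L by (intro ennreal_leI powr_mono2) auto
          then show ?thesis ..
        next
          case (2 i)
          have "L u w powr m \<le> (l ^ i * L (u - int i) w) powr m"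
            using 2 m L by (intro powr_mono2) auto
          also have "\<dots> = (l powr m) ^ i * L (u - int i) w powr m"
            using l L by (simp add: powr_mult powr_powr mult.commute flip: powr_realpow)
          finally have "X u w \<le> ennreal (l powr m) ^ i * X (u - int i) w"
            unfolding X_def by (simp add: ennreal_power ennreal_leI flip: ennreal_mult)
          with 2 show ?thesis by blast
        qed
      qed
    qed
    show "l powr m < 1" using powr_less_mono2[of m l 1] l m by simp
  qed (use r Z_bound B in \<open>auto simp: X_def\<close>)

  have "abs_log_moment M (\<epsilon> t) m
      \<le> (\<integral>\<^sup>+w. ennreal (2 powr m) * (X t w + ennreal (H t w powr m)) \<partial>M)"
    unfolding abs_log_moment_def
  proof (rule nn_integral_mono_AE)
    show "AE w in M. (if \<epsilon> t w = 0 then \<infinity> else ennreal (\<bar>ln ((\<epsilon> t w)\<^sup>2)\<bar> powr m))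
        \<le> ennreal (2 powr m) * (X t w + ennreal (H t w powr m))"
      using AE_all
    proof eventually_elim
      case (elim w)
      then have nz: "\<eta> t w \<noteq> 0" "0 < \<sigma> t w" "\<epsilon> t w = \<sigma> t w * \<eta> t w" by auto
      have "ln ((\<epsilon> t w)\<^sup>2) = ln ((\<sigma> t w)\<^sup>2) + ln ((\<eta> t w)\<^sup>2)"
        using nz by (simp add: power_mult_distrib ln_mult)
      \<comment> \<open>The two summands are indexed by \<open>bool\<close>, so that
        \<open>sum_powr_le\<close> applies with cardinality 2.\<close>
      then have "\<bar>ln ((\<epsilon> t w)\<^sup>2)\<bar> \<le> (\<Sum>x\<in>UNIV. if x then L t w else H t w)"
        unfolding L_def H_def UNIV_bool by (simp add: abs_triangle_ineq)
      then have "\<bar>ln ((\<epsilon> t w)\<^sup>2)\<bar> powr m \<le> (\<Sum>x\<in>UNIV. if x then L t w else H t w) powr m"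
        using m by (intro powr_mono2) auto
      also have "\<dots> \<le> real (card (UNIV :: bool set)) powr m
          * (\<Sum>x\<in>UNIV. (if x then L t w else H t w) powr m)"
        using m by (intro sum_powr_le) (auto simp: L_def H_def)
      also have "\<dots> = 2 powr m * (L t w powr m + H t w powr m)"
        by (simp add: UNIV_bool)
      finally show ?case
        using nz by (simp add: X_def ennreal_leI flip: ennreal_plus ennreal_mult)
    qed
  qed
  also have "\<dots> = ennreal (2 powr m) * ((\<integral>\<^sup>+w. X t w \<partial>M) + (\<integral>\<^sup>+w. ennreal (H t w powr m) \<partial>M))"
    by (simp add: nn_integral_cmult nn_integral_add)
  also have "\<dots> < \<infinity>"
    using X_finite le_less_trans[OF H_moment fin] by (simp add: ennreal_mult_less_top)
  finally show ?thesis .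
qed

theorem proposition2p3:
  fixes M :: "'a measure"
    and p q :: nat
    and \<omega> :: real
    and ap am b :: "nat \<Rightarrow> real"
    and \<eta> \<epsilon> \<sigma> :: "int \<Rightarrow> 'a \<Rightarrow> real"
    and N :: "real mat \<Rightarrow> real"
  assumes "prob_space M"
    and "max p q \<ge> 1"
    and "iid_innovations M \<eta>"
    and "log_plus_abs_log_moment M (\<eta> 0) < \<infinity>"
    and "multiplicative_matrix_norm (2 * q + p) N"
    and "top_lyapunov_exponent N (2 * q + p) M (\<lambda>t w. C_mat p q ap am b (\<eta> t w)) < 0"
  shows "(spectral_radius (map_mat complex_of_real (A_inf p q ap am b M \<eta>)) < 1 \<longleftrightarrow>
          (\<Sum>i=1..max p q. max \<bar>trunc_coef q ap i + trunc_coef p b i\<bar>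
                               \<bar>trunc_coef q am i + trunc_coef p b i\<bar>) < 1) \<and>
         (spectral_radius (map_mat complex_of_real (A_inf p q ap am b M \<eta>)) < 1 \<longrightarrow>
          stationary_log_garch_solution p q \<omega> ap am b M \<eta> \<epsilon> \<sigma> \<longrightarrow>
          (\<forall>m::real. m > 0 \<longrightarrow> abs_log_moment M (\<eta> 0) m < \<infinity> \<longrightarrow>
             (\<forall>t. abs_log_moment M (\<epsilon> t) m < \<infinity>)))"
proof -
  interpret prob_space M by (rule assms(1))
  \<comment> \<open>The integrand of the \<open>log_plus_abs_log_moment\<close> is infinite where
    the innovation vanishes, so that event is null.\<close>
  have nonzero: "AE w in M. \<eta> 0 w \<noteq> 0"
    using AE_nonzero_of_log_plus_moment[OF iid_innovations_measurable[OF assms(3)] assms(4)] .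
  have "spectral_radius (map_mat complex_of_real (A_inf p q ap am b M \<eta>)) < 1 \<longleftrightarrow>
          (\<Sum>i=1..max p q. max \<bar>trunc_coef q ap i + trunc_coef p b i\<bar>
                               \<bar>trunc_coef q am i + trunc_coef p b i\<bar>) < 1"
    by (rule spectral_radius_companion_less_1_iff[OF assms(2) _ A_inf_eq[OF assms(3) nonzero]])
       (simp add: le_max_iff_disj)
  then show ?thesis
    using log_garch_abs_log_moment_finite[OF assms(2,3) nonzero] by blast
qed

end
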